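(* (i) Let $p$ be an odd prime number, $m\ge2$ and $n=2l\ge4$. If $l$ is even: \[w_{n+2}^{\overline{1}}(\mathbb{Z}/p^{m}\mathbb{Z})=\frac{p^{(m-1)(n-1)}(p^{l+1}-1)(p^{l}-1)}{p^{2}-1},\] \[w_{n+2}^{\overline{-1}}(\mathbb{Z}/p^{m}\mathbb{Z})=p^{(m-1)(n-1)}\left(\frac{(p^{l+1}-1)(p^{l}-1)}{p^{2}-1}+p^{l}\right)+\frac{p^{(m-1)(n-1-l)}-1}{p^{n-1-l}-1}\,p^{ml-1}(p-1).\] If $l$ is odd: \[w_{n+2}^{\overline{1}}(\mathbb{Z}/p^{m}\mathbb{Z})=p^{(m-1)(n-1)}\left(\frac{(p^{l+1}-1)(p^{l}-1)}{p^{2}-1}+p^{l}\right)+\frac{p^{(m-1)(n-1-l)}-1}{p^{n-1-l}-1}\,p^{ml-1}(p-1),\] \[w_{n+2}^{\overline{-1}}(\mathbb{Z}/p^{m}\mathbb{Z})=\frac{p^{(m-1)(n-1)}(p^{l+1}-1)(p^{l}-1)}{p^{2}-1}.\] (ii) Let $m\ge3$ and $n=2l\ge4$. If $l$ is even: \[w_{n+2}^{\overline{1}}(\mathbb{Z}/2^{m}\mathbb{Z})=2^{(m-2)(n-1)}\frac{4^{n}-2^{n}}{3},\qquad w_{n+2}^{\overline{-1}}(\mathbb{Z}/2^{m}\mathbb{Z})=2^{(m-2)(n-1)}\frac{4^{n}+2^{n+1}}{3}+\frac{2^{(m-2)(n-1-l)}-1}{2^{n-1-l}-1}\,2^{ml-1}.\]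 If $l$ is odd: \[w_{n+2}^{\overline{1}}(\mathbb{Z}/2^{m}\mathbb{Z})=2^{(m-2)(n-1)}\frac{4^{n}+2^{n+1}}{3}+\frac{2^{(m-2)(n-1-l)}-1}{2^{n-1-l}-1}\,2^{ml-1},\qquad w_{n+2}^{\overline{-1}}(\mathbb{Z}/2^{m}\mathbb{Z})=2^{(m-2)(n-1)}\frac{4^{n}-2^{n}}{3}.\]
   Context: For a commutative unitary ring $A$ and $(a_1,\dots,a_n)\in A^n$, $M_{n}(a_1,\ldots,a_n):=\begin{pmatrix} a_{n} & -1_{A} \\ 1_{A} & 0_{A}\end{pmatrix}\cdots\begin{pmatrix} a_{1} & -1_{A} \\ 1_{A} & 0_{A}\end{pmatrix}$. For a unit $u$ of $A$, $w_{n}^{u}(A)$ is the number of $(a_1,\dots,a_n)\in A^n$ with $M_n(a_1,\dots,a_n)=\begin{pmatrix} u & 0_A\\ 0_A & u^{-1}\end{pmatrix}$. For an integer $a$, $\overline{a}$ denotes its class modulo the relevant modulus. *)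

theory Defs
  imports "HOL-Number_Theory.Residues"
begin

(* Mat2 a b c d has rows (a, b) and (c, d). *)
datatype 'a mat2 = Mat2 'a 'a 'a 'a

fun mat2_mult :: "('a, 'r) ring_scheme \<Rightarrow> 'a mat2 \<Rightarrow> 'a mat2 \<Rightarrow> 'a mat2" where
  "mat2_mult A (Mat2 a b c d) (Mat2 a' b' c' d') =
     Mat2 ((a \<otimes>\<^bsub>A\<^esub> a') \<oplus>\<^bsub>A\<^esub> (b \<otimes>\<^bsub>A\<^esub> c')) ((a \<otimes>\<^bsub>A\<^esub> b') \<oplus>\<^bsub>A\<^esub> (b \<otimes>\<^bsub>A\<^esub> d'))
          ((c \<otimes>\<^bsub>A\<^esub> a') \<oplus>\<^bsub>A\<^esub> (d \<otimes>\<^bsub>A\<^esub> c')) ((c \<otimes>\<^bsub>A\<^esub> b') \<oplus>\<^bsub>A\<^esub> (d \<otimes>\<^bsub>A\<^esub> d'))"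

definition mat2_one :: "('a, 'r) ring_scheme \<Rightarrow> 'a mat2" where
  "mat2_one A = Mat2 \<one>\<^bsub>A\<^esub> \<zero>\<^bsub>A\<^esub> \<zero>\<^bsub>A\<^esub> \<one>\<^bsub>A\<^esub>"

definition elem_mat :: "('a, 'r) ring_scheme \<Rightarrow> 'a \<Rightarrow> 'a mat2" where
  "elem_mat A a = Mat2 a (\<ominus>\<^bsub>A\<^esub> \<one>\<^bsub>A\<^esub>) \<one>\<^bsub>A\<^esub> \<zero>\<^bsub>A\<^esub>"

(* The list [a_1, ..., a_n] is sent to the product with the factor of a_n leftmost and
   that of a_1 rightmost, so the head of the list contributes the last factor. *)
primrec cont_mat :: "('a, 'r) ring_scheme \<Rightarrow> 'a list \<Rightarrow> 'a mat2" where
  "cont_mat A [] = mat2_one A"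
| "cont_mat A (a # as) = mat2_mult A (cont_mat A as) (elem_mat A a)"

(* Intended for a commutative ring A and a unit u of A. *)
definition w :: "('a, 'r) ring_scheme \<Rightarrow> nat \<Rightarrow> 'a \<Rightarrow> nat" where
  "w A n u = card {as. length as = n \<and> set as \<subseteq> carrier A \<and>
                       cont_mat A as = Mat2 u \<zero>\<^bsub>A\<^esub> \<zero>\<^bsub>A\<^esub> (inv\<^bsub>A\<^esub> u)}"

(* The class of a modulo N, as an element of the carrier {0..N - 1} of residue_ring N. *)
definition zclass :: "int \<Rightarrow> int \<Rightarrow> int" where
  "zclass N a = a mod N"

end

theory Submission
  imports Defs
begin

text \<open>Write $q = p^m$. The condition $M_{n+2}(a) = \pm\mathrm{Id}$ pins down $a_1$ and $a_{n+2}$ and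
  leaves the number of walks $(x, y) \mapsto (ax - y, x)$ of length $n$ from $(1, 0)$ that end with
  $x = \mp 1$. As a function of the starting vector $(x, y)$, taken nonzero modulo $p$, the number
  $g_k(x)$ of such walks of length $2k$ depends on $x$ alone, and
  $g_{k+1}(x) = \sum_{a, z} g_k(az - x)$ for $x$ a unit, $g_{k+1}(x) = q \sum_z g_k(z)$ otherwise.
  This operator is diagonalised, up to a triangular $2 \times 2$ block and the sign change
  $s \mapsto -s$, by $1$, the indicator of $p \mid x$, and
  $\theta_j(x - s) = p\,[p^{j+1} \mid x - s] - [p^j \mid x - s]$ for $j < m$, with eigenvalue
  $p^{2m-1-j}$ on $\theta_j$; expanding the initial indicator of $x = s$ in this basis yields
  the count.\<close>

section \<open>Integer matrices and the reduction to walks modulo q\<close>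

text \<open>The factor of the head is multiplied out over the integers without reduction, so that
  the determinant is an exact identity and one lift serves every modulus.\<close>

primrec imat :: "int list \<Rightarrow> int mat2" where
  "imat [] = Mat2 1 0 0 1"
| "imat (a # as) = (case imat as of Mat2 \<alpha> \<beta> \<gamma> \<delta> \<Rightarrow>
     Mat2 (\<alpha> * a + \<beta>) (- \<alpha>) (\<gamma> * a + \<delta>) (- \<gamma>))"

lemma cont_mat_residue_ring:
  assumes "q > 1"
  shows "cont_mat (residue_ring q) as = map_mat2 (\<lambda>x. x mod q) (imat as)"
proof -
  interpret residues q "residue_ring q"
    using assms by unfold_locales auto
  show ?thesis
  proof (induction as)
    case Nil
    then show ?case using assms by (simp add: mat2_one_def res_zero_eq res_one_eq)
  next
    case (Cons a as)
    have neg1: "\<ominus>\<^bsub>residue_ring q\<^esub> \<one>\<^bsub>residue_ring q\<^esub> = (- 1) mod q"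
      using res_neg_eq[of 1] by (simp add: res_one_eq)
    obtain \<alpha> \<beta> \<gamma> \<delta> where m: "imat as = Mat2 \<alpha> \<beta> \<gamma> \<delta>" by (cases "imat as")
    have m2: "(x mod q * a mod q + y mod q) mod q = (x * a + y) mod q" for x y
      by (simp add: mod_simps)
    have m3: "(x mod q * (- 1 mod q)) mod q = (- x) mod q" for x
      by (metis mod_mult_eq mult_minus1_right)
    show ?case
      by (simp add: Cons.IH m elem_mat_def neg1[unfolded res_one_eq] res_add_eq res_mult_eq res_zero_eq res_one_eq m2 m3)
  qed
qed

text \<open>Every factor has determinant 1. Later this makes the condition on the upper left entry
  of a product follow from the other conditions.\<close>

lemma imat_det:
  assumes "imat as = Mat2 \<alpha> \<beta> \<gamma> \<delta>"
  shows "\<alpha> * \<delta> - \<beta> * \<gamma> = 1"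
  using assms
proof (induction as arbitrary: \<alpha> \<beta> \<gamma> \<delta>)
  case (Cons a as)
  obtain \<alpha>' \<beta>' \<gamma>' \<delta>' where m: "imat as = Mat2 \<alpha>' \<beta>' \<gamma>' \<delta>'" by (cases "imat as")
  from Cons.IH[OF m] Cons.prems m show ?case by (auto simp: algebra_simps)
qed simp

text \<open>The walk $(x, y) \mapsto (ax - y, x)$ driven by the list, head first, ends at
  $(0, -u)$.\<close>

definition ends_at :: "int \<Rightarrow> int \<Rightarrow> int \<Rightarrow> int \<Rightarrow> int list \<Rightarrow> bool" where
  "ends_at q u x y as = (case imat as of Mat2 \<alpha> \<beta> \<gamma> \<delta> \<Rightarrow>
     q dvd \<alpha> * x + \<beta> * y \<and> q dvd \<gamma> * x + \<delta> * y + u)"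

definition paths :: "int \<Rightarrow> int \<Rightarrow> nat \<Rightarrow> int \<Rightarrow> int \<Rightarrow> int list set" where
  "paths q u k x y = {as. length as = k \<and> set as \<subseteq> {0..<q} \<and> ends_at q u x y as}"

lemma finite_paths: "finite (paths q u k x y)"
  by (rule finite_subset[OF _ finite_lists_length_eq[of "{0..<q}" k]]) (auto simp: paths_def)

text \<open>The factor of the head stands rightmost in the product, so it acts first on the vector
  (x, y).\<close>

lemma ends_at_Cons: "ends_at q u x y (a # as) \<longleftrightarrow> ends_at q u (a * x - y) x as"
proof -
  obtain \<alpha> \<beta> \<gamma> \<delta> where m: "imat as = Mat2 \<alpha> \<beta> \<gamma> \<delta>" by (cases "imat as")
  have "(\<alpha> * a + \<beta>) * x + - \<alpha> * y = \<alpha> * (a * x - y) + \<beta> * x"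
    "(\<gamma> * a + \<delta>) * x + - \<gamma> * y = \<gamma> * (a * x - y) + \<delta> * x"
    by (auto simp: algebra_simps)
  with m show ?thesis by (simp add: ends_at_def)
qed

lemma card_paths_Suc:
  "card (paths q u (Suc k) x y) = (\<Sum>a\<in>{0..<q}. card (paths q u k (a * x - y) x))"
proof -
  have "paths q u (Suc k) x y = (\<Union>a\<in>{0..<q}. (#) a ` paths q u k (a * x - y) x)"
    by (auto simp: paths_def length_Suc_conv ends_at_Cons)
  also have "card \<dots> = (\<Sum>a\<in>{0..<q}. card ((#) a ` paths q u k (a * x - y) x))"
    by (rule card_UN_disjoint) (auto simp: finite_paths)
  finally show ?thesis by (simp add: card_image)
qed

text \<open>For a tail with matrix entries \<alpha>, \<beta>, \<gamma>, \<delta>, the equation says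
  that its first column is (0, -u) and that the head is u \<delta> modulo q. Dropping the head is
  therefore a bijection onto the walks from (1, 0) with one step fewer.\<close>

lemma w_residue_ring_eq_card_paths:
  fixes q u :: int
  assumes q: "q > 1" and u: "u = 1 \<or> u = -1"
  shows "w (residue_ring q) (Suc k) (zclass q u) = card (paths q u k 1 0)"
proof -
  interpret residues q "residue_ring q"
    using q by unfold_locales auto
  let ?R = "residue_ring q"
  have inv: "inv\<^bsub>?R\<^esub> (u mod q) = u mod q"
  proof (rule comm_inv_char)
    show "(u mod q) \<otimes>\<^bsub>?R\<^esub> (u mod q) = \<one>\<^bsub>?R\<^esub>"
      using u by (auto simp: res_mult_eq res_one_eq mod_simps q)
  qed (use q in \<open>auto simp: res_carrier_eq\<close>)
  let ?S = "{as. length as = Suc k \<and> set as \<subseteq> carrier ?R \<and>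
     cont_mat ?R as = Mat2 (u mod q) \<zero>\<^bsub>?R\<^esub> \<zero>\<^bsub>?R\<^esub> (inv\<^bsub>?R\<^esub> (u mod q))}"
  have carr: "carrier ?R = {0..<q}" using q by (auto simp: res_carrier_eq)
  have key: "cont_mat ?R (a # as) = Mat2 (u mod q) \<zero>\<^bsub>?R\<^esub> \<zero>\<^bsub>?R\<^esub> (inv\<^bsub>?R\<^esub> (u mod q)) \<longleftrightarrow>
      ends_at q u 1 0 as \<and> (case imat as of Mat2 \<alpha> \<beta> \<gamma> \<delta> \<Rightarrow> a mod q = (u * \<delta>) mod q)" for a as
  proof -
    obtain \<alpha> \<beta> \<gamma> \<delta> where m: "imat as = Mat2 \<alpha> \<beta> \<gamma> \<delta>" by (cases "imat as")
    have det: "\<alpha> * \<delta> - \<beta> * \<gamma> = 1" by (rule imat_det[OF m])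
    have uu: "u * u = 1" using u by auto
    have "cont_mat ?R (a # as) = Mat2 (u mod q) \<zero>\<^bsub>?R\<^esub> \<zero>\<^bsub>?R\<^esub> (inv\<^bsub>?R\<^esub> (u mod q)) \<longleftrightarrow>
       (\<alpha> * a + \<beta>) mod q = u mod q \<and> (- \<alpha>) mod q = 0 mod q \<and>
       (\<gamma> * a + \<delta>) mod q = 0 mod q \<and> (- \<gamma>) mod q = u mod q"
      unfolding cont_mat_residue_ring[OF q] by (simp add: m inv res_zero_eq)
    also have "\<dots> \<longleftrightarrow> q dvd \<alpha> * a + \<beta> - u \<and> q dvd \<alpha> \<and> q dvd \<gamma> * a + \<delta> \<and> q dvd \<gamma> + u"
      unfolding mod_eq_dvd_iff using dvd_minus_iff[of q "\<gamma> + u"] by simp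
    also have "\<dots> \<longleftrightarrow> q dvd \<alpha> \<and> q dvd \<gamma> + u \<and> q dvd a - u * \<delta>"
    proof safe
      assume h: "q dvd \<alpha>" "q dvd \<gamma> * a + \<delta>" "q dvd \<gamma> + u"
      have "a - u * \<delta> = u * (a * (\<gamma> + u) - (\<gamma> * a + \<delta>))"
        using uu by (simp add: algebra_simps)
      then show "q dvd a - u * \<delta>" using h by simp
    next
      assume h: "q dvd \<alpha>" "q dvd a - u * \<delta>" "q dvd \<gamma> + u"
      have "\<gamma> * a + \<delta> = a * (\<gamma> + u) - u * (a - u * \<delta>)"
        using uu by (simp add: algebra_simps)
      then show "q dvd \<gamma> * a + \<delta>" using h by simp
      \<comment> \<open>The determinant relation multiplied by u rewrites \<beta> - u so that every
        term contains \<alpha> or \<gamma> + u.\<close>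
      have "\<alpha> * a + \<beta> - u = \<alpha> * a + u * (\<beta> * (\<gamma> + u)) - u * (\<alpha> * \<delta>)"
      proof -
        have "u * (\<beta> * (\<gamma> + u)) = u * (\<beta> * \<gamma>) + \<beta> * (u * u)"
          by (simp add: algebra_simps)
        moreover have "\<alpha> * \<delta> = 1 + \<beta> * \<gamma>" using det by simp
        ultimately show ?thesis using uu by (simp add: algebra_simps)
      qed
      also have "q dvd \<dots>" using h by simp
      finally show "q dvd \<alpha> * a + \<beta> - u" .
    qed
    also have "\<dots> \<longleftrightarrow> ends_at q u 1 0 as \<and> a mod q = (u * \<delta>) mod q"
      by (simp add: ends_at_def m mod_eq_dvd_iff)
    finally show ?thesis by (simp add: m)
  qed
  \<comment> \<open>The forced head, reduced so that it lies in the carrier.\<close>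
  define f where "f as = (case imat as of Mat2 \<alpha> \<beta> \<gamma> \<delta> \<Rightarrow> (u * \<delta>) mod q)" for as
  have "?S = (\<lambda>as. f as # as) ` paths q u k 1 0"
  proof safe
    fix as assume h: "length as = Suc k" "set as \<subseteq> carrier ?R"
      "cont_mat ?R as = Mat2 (u mod q) \<zero>\<^bsub>?R\<^esub> \<zero>\<^bsub>?R\<^esub> (inv\<^bsub>?R\<^esub> (u mod q))"
    then obtain a bs where as: "as = a # bs" by (cases as) auto
    have "a = f bs"
      using h key[of a bs] carr unfolding as by (cases "imat bs") (auto simp: f_def)
    then show "as \<in> (\<lambda>as. f as # as) ` paths q u k 1 0"
      using h key[of a bs] carr unfolding as by (auto simp: paths_def)
  next
    fix as assume h: "as \<in> paths q u k 1 0"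
    have "f as \<in> {0..<q}" using q by (cases "imat as") (auto simp: f_def)
    moreover have "case imat as of Mat2 \<alpha> \<beta> \<gamma> \<delta> \<Rightarrow> f as mod q = (u * \<delta>) mod q"
      by (cases "imat as") (auto simp: f_def)
    ultimately show "cont_mat ?R (f as # as) =
        Mat2 (u mod q) \<zero>\<^bsub>?R\<^esub> \<zero>\<^bsub>?R\<^esub> (inv\<^bsub>?R\<^esub> (u mod q))"
      and "length (f as # as) = Suc k"
      and "\<And>x. x \<in> set (f as # as) \<Longrightarrow> x \<in> carrier ?R"
      using h key[of "f as" as] carr by (auto simp: paths_def)
  qed
  then have "card ?S = card (paths q u k 1 0)"
    by (simp add: card_image inj_on_def)
  then show ?thesis by (simp add: w_def zclass_def)
qed

section \<open>Sums over residues and counts of divisibility conditions\<close>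

text \<open>An injective self-map of the finite set of residues is a bijection, so modulo q the map
  \<open>h\<close> only permutes the summands.\<close>

lemma sum_residues_shift:
  fixes f :: "int \<Rightarrow> 'a::comm_monoid_add" and h :: "int \<Rightarrow> int"
  assumes q: "q > 0"
    and per: "\<And>x. f (x mod q) = f x"
    and inj: "\<And>x y. \<lbrakk>x \<in> {0..<q}; y \<in> {0..<q}; q dvd h x - h y\<rbrakk> \<Longrightarrow> x = y"
  shows "(\<Sum>b\<in>{0..<q}. f (h b)) = (\<Sum>z\<in>{0..<q}. f z)"
proof -
  have "inj_on (\<lambda>b. h b mod q) {0..<q}"
    by (rule inj_onI) (auto intro!: inj simp: mod_eq_dvd_iff)
  moreover have "(\<lambda>b. h b mod q) ` {0..<q} \<subseteq> {0..<q}" using q by auto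
  ultimately have "bij_betw (\<lambda>b. h b mod q) {0..<q} {0..<q}"
    by (simp add: bij_betw_def endo_inj_surj)
  from sum.reindex_bij_betw[OF this, of f] show ?thesis by (simp add: per)
qed

lemma sum_residues_affine:
  fixes f :: "int \<Rightarrow> 'a::comm_monoid_add"
  assumes q: "q > 0" and per: "\<And>x. f (x mod q) = f x" and "coprime x q"
  shows "(\<Sum>b\<in>{0..<q}. f (b * x + c)) = (\<Sum>z\<in>{0..<q}. f z)"
proof (rule sum_residues_shift[where h = "\<lambda>b. b * x + c"])
  fix b b' assume b: "b \<in> {0..<q}" "b' \<in> {0..<q}" and "q dvd b * x + c - (b' * x + c)"
  then have "q dvd (b - b') * x" by (simp add: algebra_simps)
  then have "q dvd b - b'" using assms(3) by (metis coprime_commute coprime_dvd_mult_left_iff)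
  then show "b = b'" using b by (metis atLeastLessThan_iff mod_eq_dvd_iff mod_pos_pos_trivial)
qed (use q per in auto)

lemma dvd_mod_minus_iff:
  fixes d q x s :: int
  assumes "d dvd q"
  shows "d dvd x mod q - s \<longleftrightarrow> d dvd x - s"
proof -
  have "d dvd x mod q - x" using assms by (metis dvd_trans mod_eq_dvd_iff mod_mod_trivial)
  then show ?thesis using dvd_add_right_iff[of d "x mod q - x" "x - s"] by simp
qed

text \<open>The range consists of M periods of length d, and each period contains exactly one number
  congruent to v.\<close>

lemma sum_of_bool_dvd_shift:
  fixes d M v :: int
  assumes "d > 0" "M \<ge> 0"
  shows "(\<Sum>z\<in>{0..<d * M}. of_bool (d dvd z - v)) = real_of_int M"
proof -
  have "{z \<in> {0..<d * M}. d dvd z - v} = (\<lambda>t. t * d + v mod d) ` {0..<M}"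
  proof safe
    fix z assume z: "z \<in> {0..<d * M}" "d dvd z - v"
    have "z mod d = v mod d" using z(2) by (simp add: mod_eq_dvd_iff)
    then have "z = z div d * d + v mod d" by (metis div_mult_mod_eq)
    moreover have "z div d < M"
    proof (rule mult_right_less_imp_less)
      show "z div d * d < M * d"
        using z(1) assms div_mult_mod_eq[of z d] pos_mod_sign[OF assms(1), of z]
        by (simp only: atLeastLessThan_iff mult.commute[of M]) linarith
    qed (use assms in simp)
    then have "z div d \<in> {0..<M}"
      using z(1) assms by (simp add: pos_imp_zdiv_nonneg_iff)
    ultimately show "z \<in> (\<lambda>t. t * d + v mod d) ` {0..<M}" by blast
  next
    fix t assume t: "t \<in> {0..<M}"
    have "0 \<le> v mod d" "v mod d < d" using assms by auto
    moreover have "t * d \<le> (M - 1) * d" "0 \<le> t * d" using t assms by (auto intro: mult_right_mono)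
    ultimately show "t * d + v mod d \<in> {0..<d * M}" by (auto simp: algebra_simps)
    have "t * d + v mod d - v = (t - v div d) * d" by (simp add: algebra_simps minus_mod_eq_mult_div)
    then show "d dvd t * d + v mod d - v" by simp
  qed
  moreover have "inj_on (\<lambda>t. t * d + v mod d) {0..<M}" using assms by (auto simp: inj_on_def)
  ultimately have "card {z \<in> {0..<d * M}. d dvd z - v} = nat M" by (simp add: card_image)
  then show ?thesis using assms by (simp add: of_bool_def sum.If_cases Int_def)
qed

text \<open>The factor on the left stands for division by \<open>p ^ i\<close>; this keeps the
  truncated difference m - i out of later computations.\<close>

lemma sum_of_bool_prime_power_dvd:
  fixes p :: nat
  assumes "prime p" "i \<le> m"
  shows "real p ^ i * (\<Sum>z\<in>{0..<int p ^ m}. of_bool (int p ^ i dvd z - v)) = real p ^ m"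
proof -
  have "int p ^ m = int p ^ i * int p ^ (m - i)" using assms(2) by (simp flip: power_add)
  moreover have "real p ^ m = real p ^ i * real p ^ (m - i)" using assms(2) by (simp flip: power_add)
  ultimately show ?thesis
    using sum_of_bool_dvd_shift[of "int p ^ i" "int p ^ (m - i)" v] prime_gt_0_nat[OF assms(1)]
    by simp
qed

text \<open>For a prime p this separates units from multiples and writes the latter as p z, which is
  the descent in the valuation induction below.\<close>

lemma sum_split_multiples:
  fixes f :: "int \<Rightarrow> 'a::comm_monoid_add" and p M :: int
  assumes "p > 0" "M \<ge> 0"
  shows "(\<Sum>z\<in>{0..<p * M}. f z) = (\<Sum>z\<in>{z\<in>{0..<p * M}. \<not> p dvd z}. f z) + (\<Sum>z\<in>{0..<M}. f (p * z))"
proof -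
  have "{z \<in> {0..<p * M}. p dvd z} = (*) p ` {0..<M}"
    using assms by (auto simp: image_iff zero_le_mult_iff elim!: dvdE)
  moreover have "inj_on ((*) p) {0..<M}" using assms by (auto simp: inj_on_def)
  ultimately have "(\<Sum>z\<in>{z\<in>{0..<p * M}. p dvd z}. f z) = (\<Sum>z\<in>{0..<M}. f (p * z))"
    by (simp add: sum.reindex)
  moreover have "(\<Sum>z\<in>{0..<p * M}. f z) =
      (\<Sum>z\<in>{z\<in>{0..<p * M}. \<not> p dvd z}. f z) + (\<Sum>z\<in>{z\<in>{0..<p * M}. p dvd z}. f z)"
    by (subst sum.union_disjoint[symmetric])
      (auto intro!: sum.cong finite_subset[OF _ finite_atLeastLessThan_int[of 0 "p * M"]])
  ultimately show ?thesis by simp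
qed

lemma card_nonmultiples:
  fixes p M :: int
  assumes "p > 0" "M \<ge> 0"
  shows "real (card {z\<in>{0..<p * M}. \<not> p dvd z}) = real_of_int ((p - 1) * M)"
  using sum_split_multiples[OF assms, of "\<lambda>_. 1 :: real"] assms by (simp add: algebra_simps)

text \<open>The sum over $j$ counts the possible valuations of $z$; the induction divides
  $z$ and $v$ by $p$, which is why the two ranges have independent exponents.\<close>

lemma sum_of_bool_dvd_mult_minus:
  fixes p :: nat
  assumes p: "prime p" and "i \<le> A" "i \<le> Z"
  shows "real p ^ (i + 1) *
      (\<Sum>z\<in>{0..<int p ^ Z}. \<Sum>a\<in>{0..<int p ^ A}. of_bool (int p ^ i dvd a * z - v)) =
    real p ^ (A + Z) * ((real p - 1) * (\<Sum>j<i. of_bool (int p ^ j dvd v))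
      + real p * of_bool (int p ^ i dvd v))"
  using assms(2,3)
proof (induction i arbitrary: Z v)
  case 0
  then show ?case using prime_gt_0_nat[OF p] by (simp add: power_add)
next
  case (Suc i)
  then obtain Z' where Z: "Z = Suc Z'" by (cases Z) auto
  have p0: "int p > 0" and pr: "prime (int p)" using prime_gt_0_nat[OF p] p by auto
  let ?P = "int p"
  let ?S = "\<lambda>i v z. \<Sum>a\<in>{0..<?P ^ A}. of_bool (?P ^ i dvd a * z - v) :: real"
  \<comment> \<open>For a unit z the map a \<mapsto> a z permutes the residues modulo
    \<open>p ^ A\<close>, so the inner sum no longer depends on z.\<close>
  have unit: "real p ^ Suc i * ?S (Suc i) v z = real p ^ A" if "\<not> ?P dvd z" for z
  proof -
    have cop: "coprime z (?P ^ A)"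
      using that pr by (metis coprime_commute coprime_power_left_iff prime_imp_coprime)
    have per: "(of_bool (?P ^ Suc i dvd x mod ?P ^ A - v) :: real) = of_bool (?P ^ Suc i dvd x - v)" for x
      using Suc.prems by (subst dvd_mod_minus_iff) (auto intro: le_imp_power_dvd simp del: power_Suc)
    have "?S (Suc i) v z = (\<Sum>a\<in>{0..<?P ^ A}. of_bool (?P ^ Suc i dvd a - v))"
      using sum_residues_affine[where f = "\<lambda>x. of_bool (?P ^ Suc i dvd x - v) :: real",
          OF _ per cop, of 0] p0 by simp
    then show ?thesis using sum_of_bool_prime_power_dvd[OF p Suc.prems(1)] by simp
  qed
  \<comment> \<open>For a multiple of p the condition forces p to divide v, and then one factor p
    cancels throughout.\<close>
  have mult: "?S (Suc i) v (?P * z) = of_bool (?P dvd v) * ?S i (v div ?P) z" for z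
  proof (cases "?P dvd v")
    case True
    then obtain v' where v: "v = ?P * v'" ..
    have "?P ^ Suc i dvd a * (?P * z) - v \<longleftrightarrow> ?P ^ i dvd a * z - v'" for a
    proof -
      have "a * (?P * z) - v = ?P * (a * z - v')" by (simp add: v algebra_simps)
      then show ?thesis using p0 by simp
    qed
    then show ?thesis using v p0 by simp
  next
    case False
    have "\<not> ?P ^ Suc i dvd a * (?P * z) - v" for a
    proof
      assume "?P ^ Suc i dvd a * (?P * z) - v"
      then have "?P dvd a * (?P * z) - v" by (metis dvd_mult_left power_Suc)
      then have "?P dvd v" by (metis dvd_diff_right_iff dvd_mult dvd_triv_left)
      with False show False ..
    qed
    then show ?thesis using False by simp
  qed
  \<comment> \<open>This shifts the sum over j by one: the term j = 0 is 1 and accounts for the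
    units z, while the remaining terms come from the induction hypothesis at v div p.\<close>
  have dvdw: "of_bool (?P ^ Suc j dvd v) = (of_bool (?P dvd v) * of_bool (?P ^ j dvd v div ?P) :: real)" for j
    using p0 by (cases "?P dvd v") (auto elim!: dvdE simp: dest: dvd_mult_left)
  have "(\<Sum>z\<in>{0..<?P ^ Z}. ?S (Suc i) v z) =
      (\<Sum>z\<in>{z\<in>{0..<?P * ?P ^ Z'}. \<not> ?P dvd z}. ?S (Suc i) v z)
      + of_bool (?P dvd v) * (\<Sum>z\<in>{0..<?P ^ Z'}. ?S i (v div ?P) z)"
    unfolding Z power_Suc[of ?P Z'] using p0
    by (subst sum_split_multiples) (simp_all only: mult sum_distrib_left[symmetric], simp_all)
  moreover have "real p ^ Suc i * (\<Sum>z\<in>{z\<in>{0..<?P * ?P ^ Z'}. \<not> ?P dvd z}. ?S (Suc i) v z)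
      = (real p - 1) * real p ^ (A + Z')"
  proof -
    have "(\<Sum>z\<in>{z\<in>{0..<?P * ?P ^ Z'}. \<not> ?P dvd z}. real p ^ Suc i * ?S (Suc i) v z) =
        (\<Sum>z\<in>{z\<in>{0..<?P * ?P ^ Z'}. \<not> ?P dvd z}. real p ^ A)"
      by (intro sum.cong refl unit) simp
    also have "\<dots> = (real p - 1) * real p ^ (A + Z')"
      using card_nonmultiples[of ?P "?P ^ Z'"] p0 by (simp add: power_add)
    finally show ?thesis by (simp only: sum_distrib_left)
  qed
  moreover have "real p ^ (i + 1) * (\<Sum>z\<in>{0..<?P ^ Z'}. ?S i (v div ?P) z) =
    real p ^ (A + Z') * ((real p - 1) * (\<Sum>j<i. of_bool (?P ^ j dvd v div ?P))
      + real p * of_bool (?P ^ i dvd v div ?P))"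
    by (rule Suc.IH) (use Suc.prems Z in auto)
  ultimately have "real p ^ (i + 1) * (\<Sum>z\<in>{0..<?P ^ Z}. ?S (Suc i) v z) =
     (real p - 1) * real p ^ (A + Z') + of_bool (?P dvd v) * (real p ^ (A + Z') * ((real p - 1) *
       (\<Sum>j<i. of_bool (?P ^ j dvd v div ?P)) + real p * of_bool (?P ^ i dvd v div ?P)))"
    by (simp add: algebra_simps)
  also have "\<dots> = real p ^ (A + Z') * ((real p - 1) * (\<Sum>j<Suc i. of_bool (?P ^ j dvd v))
      + real p * of_bool (?P ^ Suc i dvd v))"
    unfolding sum.lessThan_Suc_shift dvdw by (simp add: sum_distrib_left algebra_simps)
  finally show ?case
    by (simp only: Z add_Suc add_Suc_right power_Suc[of "real p"] mult.assoc)
qed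

section \<open>The eigenfunctions of the double-step operator\<close>

declare sum_of_bool_eq [simp del] sum_of_bool_mult_eq [simp del]

text \<open>Multiplied by \<open>p ^ j\<close>, this is the difference of the indicators of
  divisibility by \<open>p ^ (j + 1)\<close> and \<open>p ^ j\<close>, each scaled to have mean 1.
  So it has mean 0, and sums over j telescope.\<close>

definition theta :: "nat \<Rightarrow> nat \<Rightarrow> int \<Rightarrow> real" where
  "theta p j y = real p * of_bool (int p ^ Suc j dvd y) - of_bool (int p ^ j dvd y)"

lemma theta_mod:
  assumes "j < m"
  shows "theta p j (x mod int p ^ m - s) = theta p j (x - s)"
proof -
  have "int p ^ Suc j dvd int p ^ m" "int p ^ j dvd int p ^ m"
    using assms by (auto intro!: le_imp_power_dvd simp del: power_Suc)
  then show ?thesis by (simp add: theta_def dvd_mod_minus_iff del: power_Suc)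
qed

lemma sum_theta:
  assumes "prime p" "j < m"
  shows "(\<Sum>z\<in>{0..<int p ^ m}. theta p j (z - v)) = 0"
proof -
  have r: "real p > 0" using prime_gt_0_nat[OF assms(1)] by simp
  define S where "S i = (\<Sum>z\<in>{0..<int p ^ m}. of_bool (int p ^ i dvd z - v) :: real)" for i
  have "real p ^ Suc j * S (Suc j) = real p ^ m" "real p ^ j * S j = real p ^ m"
    using sum_of_bool_prime_power_dvd[OF assms(1)] assms(2) by (auto simp: S_def simp del: power_Suc)
  then have "real p ^ j * (real p * S (Suc j) - S j) = 0" by (simp add: algebra_simps)
  then have "real p * S (Suc j) - S j = 0" using r by simp
  then show ?thesis by (simp add: theta_def S_def sum_subtractf sum_distrib_left del: power_Suc)
qed

text \<open>The eigenvalue property. In the difference of the counts for j + 1 and j, the sums over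
  valuations cancel up to the term of index j, and what is left is again
  \<open>theta p j v\<close>.\<close>

lemma sum_sum_theta:
  assumes "prime p" "j < m"
  shows "real p ^ Suc j * (\<Sum>z\<in>{0..<int p ^ m}. \<Sum>a\<in>{0..<int p ^ m}. theta p j (a * z - v)) =
    real p ^ (2 * m) * theta p j v"
proof -
  define Q where "Q i = (\<Sum>z\<in>{0..<int p ^ m}. \<Sum>a\<in>{0..<int p ^ m}. of_bool (int p ^ i dvd a * z - v) :: real)" for i
  have Q: "real p ^ (i + 1) * Q i = real p ^ (2 * m) * ((real p - 1) * (\<Sum>k<i. of_bool (int p ^ k dvd v))
      + real p * of_bool (int p ^ i dvd v))" if "i \<le> m" for i
    using sum_of_bool_dvd_mult_minus[OF assms(1) that that] unfolding Q_def mult_2 .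
  have "(\<Sum>z\<in>{0..<int p ^ m}. \<Sum>a\<in>{0..<int p ^ m}. theta p j (a * z - v)) = real p * Q (Suc j) - Q j"
    by (simp add: theta_def Q_def sum_subtractf sum_distrib_left del: power_Suc)
  also have "real p ^ Suc j * \<dots> = real p ^ (Suc j + 1) * Q (Suc j) - real p ^ (j + 1) * Q j"
    by (simp add: algebra_simps)
  also have "\<dots> = real p ^ (2 * m) * theta p j v"
    using assms(2) by (subst (1 2) Q) (auto simp: theta_def algebra_simps simp del: power_Suc)
  finally show ?thesis .
qed

text \<open>The telescoping expansion of the indicator of divisibility by \<open>p ^ m\<close>; it
  supplies the initial data of the recursion.\<close>

lemma sum_power_theta:
  "(\<Sum>j<m. real p ^ j * theta p j y) = real p ^ m * of_bool (int p ^ m dvd y) - 1"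
  by (induction m) (simp_all add: theta_def algebra_simps del: power_Suc, simp)

section \<open>Recursion for the number of walks\<close>

text \<open>Two steps lead from (x, y) to (a z - x, z) with z = b x - y. If x is a unit, z runs
  through all residues as b does. If p divides x, then y is a unit, hence so is z for every b, and a
  z - x runs through all residues as a does.\<close>

lemma card_paths_two_steps:
  fixes g :: "int \<Rightarrow> real"
  assumes p: "prime p" and q: "q = int p ^ m"
    and per: "\<And>x. g (x mod q) = g x"
    and g: "\<And>x y. \<not> (int p dvd x \<and> int p dvd y) \<Longrightarrow> real (card (paths q u k x y)) = g x"
    and xy: "\<not> (int p dvd x \<and> int p dvd y)"
  shows "real (card (paths q u (Suc (Suc k)) x y)) =
    (if int p dvd x then q * (\<Sum>z\<in>{0..<q}. g z) else \<Sum>z\<in>{0..<q}. \<Sum>a\<in>{0..<q}. g (a * z - x))"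
proof -
  have q0: "q > 0" using prime_gt_0_nat[OF p] q by simp
  have cop: "coprime z q" if "\<not> int p dvd z" for z
    using that p unfolding q by (metis coprime_commute coprime_power_left_iff prime_imp_coprime prime_nat_int_transfer)
  \<comment> \<open>Vectors that are nonzero modulo p stay so, which is what allows \<open>g\<close>
    to be used after the two steps.\<close>
  have nd: "\<not> (int p dvd a * (b * x - y) - x \<and> int p dvd b * x - y)" for a b
  proof
    assume h: "int p dvd a * (b * x - y) - x \<and> int p dvd b * x - y"
    then have "int p dvd x" by (metis dvd_diff_right_iff dvd_mult)
    moreover from this h have "int p dvd y" by (metis dvd_diff_right_iff dvd_mult)
    ultimately show False using xy by simp
  qed
  have "real (card (paths q u (Suc (Suc k)) x y)) =
      (\<Sum>b\<in>{0..<q}. \<Sum>a\<in>{0..<q}. g (a * (b * x - y) - x))"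
    by (simp add: card_paths_Suc g[OF nd])
  also have "\<dots> = (if int p dvd x then q * (\<Sum>z\<in>{0..<q}. g z) else \<Sum>z\<in>{0..<q}. \<Sum>a\<in>{0..<q}. g (a * z - x))"
  proof (cases "int p dvd x")
    case True
    have "(\<Sum>a\<in>{0..<q}. g (a * (b * x - y) - x)) = (\<Sum>z\<in>{0..<q}. g z)" for b
    proof -
      have "\<not> int p dvd b * x - y" using True xy by (metis dvd_diff_right_iff dvd_mult)
      from sum_residues_affine[where f = g, OF q0 per cop[OF this], of "- x"] show ?thesis by simp
    qed
    then show ?thesis using True q0 by simp
  next
    case False
    have "g (a * (z mod q) - x) = g (a * z - x)" for a z
      by (metis per mod_diff_left_eq mod_mult_right_eq)
    then have "(\<Sum>b\<in>{0..<q}. \<Sum>a\<in>{0..<q}. g (a * (b * x + - y) - x)) = (\<Sum>z\<in>{0..<q}. \<Sum>a\<in>{0..<q}. g (a * z - x))"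
      by (intro sum_residues_affine[where f = "\<lambda>z. \<Sum>a\<in>{0..<q}. g (a * z - x)"] q0 cop False) simp
    then show ?thesis using False by simp
  qed
  finally show ?thesis .
qed

text \<open>The last step must arrive at (0, -u). Its second coordinate forces x = -u modulo q; x is
  then a unit, and a x = y has exactly one solution a.\<close>

lemma card_paths_1:
  assumes p: "prime p" and q: "q = int p ^ Suc M" and u: "u = 1 \<or> u = -1"
  shows "card (paths q u (Suc 0) x y) = of_bool (q dvd x + u)"
proof -
  have q0: "q > 0" using prime_gt_0_nat[OF p] q by simp
  have emp: "paths q u 0 x y = (if q dvd x \<and> q dvd y + u then {[]} else {})" for x y
    by (auto simp: paths_def ends_at_def)
  show ?thesis
  proof (cases "q dvd x + u")
    case True
    have "coprime x q"
    proof (rule coprimeI)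
      fix c assume "c dvd x" "c dvd q"
      then have "c dvd u" using True by (metis dvd_add_right_iff dvd_trans)
      then show "is_unit c" using u by auto
    qed
    then have "(\<Sum>a\<in>{0..<q}. of_bool (q dvd a * x + - y)) = (\<Sum>z\<in>{0..<q}. of_bool (q dvd z) :: nat)"
      by (intro sum_residues_affine[where f = "\<lambda>z. of_bool (q dvd z)"] q0) (simp_all add: dvd_mod_iff)
    also have "\<dots> = (\<Sum>z\<in>{0..<q}. of_bool (z = 0))"
      by (intro sum.cong) (auto dest: zdvd_imp_le)
    also have "\<dots> = 1" using q0 by (simp add: of_bool_def)
    finally show ?thesis using True by (simp add: card_paths_Suc emp of_bool_def if_distrib cong: if_cong)
  next
    case False
    then show ?thesis by (simp add: card_paths_Suc emp)
  qed
qed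

section \<open>The closed form for the number of walks\<close>

text \<open>For r = p, the normalised coefficient of the constant function 1 after k double steps;
  it starts at 1 for k = 0.\<close>

definition coeff_one :: "real \<Rightarrow> nat \<Rightarrow> real" where
  "coeff_one r k = r ^ k + r * (r ^ (k + 1) - 1) * (r ^ k - 1) / (r\<^sup>2 - 1)"

text \<open>For r > 1 this is r + r^2 + ... + r^k, the matching coefficient of the indicator of p |
  x.\<close>

definition coeff_nonunit :: "real \<Rightarrow> nat \<Rightarrow> real" where
  "coeff_nonunit r k = (r ^ (k + 1) - r) / (r - 1)"

lemma coeff_nonunit_Suc:
  assumes "r > 1"
  shows "coeff_nonunit r (Suc k) = coeff_nonunit r k + r ^ Suc k"
  using assms by (simp add: coeff_nonunit_def field_simps)

text \<open>The triangular block at a unit x, with a common power of p removed: the constant 1 is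
  multiplied by r^2, and the indicator of p | x feeds r - 1 into the constant.\<close>

lemma coeff_one_Suc:
  assumes "r > 1"
  shows "coeff_one r (Suc k) = r\<^sup>2 * coeff_one r k + (r - 1) * coeff_nonunit r k"
proof -
  define X where "X = r ^ k"
  have d: "r\<^sup>2 - 1 \<noteq> 0" using assms by (simp add: power2_eq_1_iff)
  have "r * (r * (r * X) - 1) * (r * X - 1) =
      r\<^sup>2 * (r * (r * X - 1) * (X - 1)) + (r\<^sup>2 * X - r) * (r\<^sup>2 - 1)"
    by (simp add: algebra_simps power2_eq_square)
  then have "r * (r * (r * X) - 1) * (r * X - 1) / (r\<^sup>2 - 1) =
      r\<^sup>2 * (r * (r * X - 1) * (X - 1) / (r\<^sup>2 - 1)) + (r\<^sup>2 * X - r)"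
    using d by (simp add: add_divide_distrib)
  moreover have "(r - 1) * coeff_nonunit r k = r * X - r"
    using assms by (simp add: coeff_nonunit_def X_def)
  ultimately show ?thesis
    by (simp add: coeff_one_def X_def[symmetric] distrib_left)
qed

text \<open>Here $q = p^{M+1}$ and $k$ double steps remain before the last one.\<close>

definition path_count :: "nat \<Rightarrow> nat \<Rightarrow> nat \<Rightarrow> int \<Rightarrow> int \<Rightarrow> real" where
  "path_count p M k s x =
     (real p ^ (2 * M * k) * (coeff_one p k + coeff_nonunit p k * of_bool (int p dvd x))
      + (\<Sum>j<Suc M. real p ^ j * real p ^ ((2 * M + 1 - j) * k) * theta p j (x - s))) / real p ^ Suc M"

lemma path_count_mod: "path_count p M k s (x mod int p ^ Suc M) = path_count p M k s x"
proof -
  have "int p dvd x mod int p ^ Suc M \<longleftrightarrow> int p dvd x"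
    by (rule dvd_mod_iff) simp
  moreover have "(\<Sum>j<Suc M. real p ^ j * real p ^ ((2 * M + 1 - j) * k) * theta p j (x mod int p ^ Suc M - s))
    = (\<Sum>j<Suc M. real p ^ j * real p ^ ((2 * M + 1 - j) * k) * theta p j (x - s))"
    by (intro sum.cong refl) (simp add: theta_mod del: power_Suc)
  ultimately show ?thesis by (simp only: path_count_def)
qed

text \<open>All \<open>theta\<close> terms have mean 0, so only the constant and the indicator of p
  | z survive.\<close>

lemma sum_path_count:
  assumes p: "prime p"
  shows "(\<Sum>z\<in>{0..<int p ^ Suc M}. path_count p M k s z) =
    real p ^ (2 * M * k) * (coeff_one p k + coeff_nonunit p k / real p)"
proof -
  have r: "real p > 0" using prime_gt_0_nat[OF p] by simp
  have "(\<Sum>z\<in>{0..<int p ^ Suc M}. \<Sum>j<Suc M. real p ^ j * real p ^ ((2 * M + 1 - j) * k) * theta p j (z - s)) = 0"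
    using sum_theta[OF p]
    by (subst sum.swap) (simp add: sum_distrib_left[symmetric] del: power_Suc sum.lessThan_Suc)
  moreover have "real p * (\<Sum>z\<in>{0..<int p ^ Suc M}. of_bool (int p dvd z)) = real p ^ Suc M"
    using sum_of_bool_prime_power_dvd[OF p, of 1 "Suc M" 0] by simp
  then have "(\<Sum>z\<in>{0..<int p ^ Suc M}. of_bool (int p dvd z)) = real p ^ Suc M / real p"
    using r by (simp add: field_simps)
  ultimately show ?thesis using r
    unfolding path_count_def sum_divide_distrib[symmetric] sum.distrib sum_distrib_left[symmetric]
    by (simp add: field_simps)
qed

text \<open>The sign of s flips because a z - x - s = a z - (x + s), and the eigenfunction
  \<open>theta p j\<close> is reproduced at x + s = x - (-s).\<close>

lemma sum_sum_path_count:
  assumes p: "prime p" and x: "\<not> int p dvd x"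
  shows "(\<Sum>z\<in>{0..<int p ^ Suc M}. \<Sum>a\<in>{0..<int p ^ Suc M}. path_count p M k s (a * z - x)) =
    path_count p M (Suc k) (- s) x"
proof -
  have r: "real p > 1" using prime_gt_1_nat[OF p] by simp
  let ?I = "{0..<int p ^ Suc M}"
  let ?T = "\<lambda>j. \<Sum>z\<in>?I. \<Sum>a\<in>?I. theta p j (a * z - (x + s))"
  have T: "real p ^ j * real p ^ ((2 * M + 1 - j) * k) * ?T j =
     real p ^ j * real p ^ ((2 * M + 1 - j) * Suc k) * theta p j (x + s)" if "j < Suc M" for j
  proof -
    have "real p ^ Suc j * ?T j = real p ^ (2 * Suc M) * theta p j (x + s)"
      by (rule sum_sum_theta[OF p that])
    \<comment> \<open>The exponent is split to exhibit the eigenvalue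
      \<open>p ^ (2 * M + 1 - j)\<close>.\<close>
    also have "2 * Suc M = Suc j + (2 * M + 1 - j)" using that by simp
    finally have "real p ^ Suc j * ?T j = real p ^ Suc j * (real p ^ (2 * M + 1 - j) * theta p j (x + s))"
      by (simp only: power_add mult.assoc)
    then have "?T j = real p ^ (2 * M + 1 - j) * theta p j (x + s)" using r by simp
    then show ?thesis by (simp only: mult_Suc_right power_add) (simp only: mult_ac)
  qed
  have arg: "a * z - x - s = a * z - (x + s)" for a z by simp
  have th: "(\<Sum>z\<in>?I. \<Sum>a\<in>?I. \<Sum>j<Suc M. real p ^ j * real p ^ ((2 * M + 1 - j) * k) * theta p j (a * z - x - s))
     = (\<Sum>j<Suc M. real p ^ j * real p ^ ((2 * M + 1 - j) * Suc k) * theta p j (x + s))" (is "?L = _")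
  proof -
    have "?L = (\<Sum>z\<in>?I. \<Sum>j<Suc M. \<Sum>a\<in>?I. real p ^ j * real p ^ ((2 * M + 1 - j) * k) * theta p j (a * z - (x + s)))"
      unfolding arg by (intro sum.cong refl sum.swap)
    also have "\<dots> = (\<Sum>j<Suc M. real p ^ j * real p ^ ((2 * M + 1 - j) * k) * ?T j)"
      by (subst sum.swap) (simp only: sum_distrib_left)
    also have "\<dots> = (\<Sum>j<Suc M. real p ^ j * real p ^ ((2 * M + 1 - j) * Suc k) * theta p j (x + s))"
      by (intro sum.cong refl T) simp
    finally show ?thesis .
  qed
  have "real p ^ 2 * (\<Sum>z\<in>?I. \<Sum>a\<in>?I. of_bool (int p dvd a * z - x)) = real p ^ 2 * (real p ^ (2 * M) * (real p - 1))"
    using sum_of_bool_dvd_mult_minus[OF p, of 1 "Suc M" "Suc M" x] x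
    by (simp add: power2_eq_square algebra_simps flip: mult_2)
  then have psi: "(\<Sum>z\<in>?I. \<Sum>a\<in>?I. of_bool (int p dvd a * z - x)) = real p ^ (2 * M) * (real p - 1)"
    using r by simp
  have "(\<Sum>z\<in>?I. \<Sum>a\<in>?I. path_count p M k s (a * z - x)) =
     (real p ^ (2 * M * k) * (coeff_one p k * (real p ^ Suc M * real p ^ Suc M) + coeff_nonunit p k * (real p ^ (2 * M) * (real p - 1)))
     + (\<Sum>j<Suc M. real p ^ j * real p ^ ((2 * M + 1 - j) * Suc k) * theta p j (x + s))) / real p ^ Suc M"
    unfolding path_count_def sum_divide_distrib[symmetric] sum.distrib sum_distrib_left[symmetric] th psi
    by (simp add: mult_ac del: sum.lessThan_Suc)
  also have "real p ^ (2 * M * k) * (coeff_one p k * (real p ^ Suc M * real p ^ Suc M) + coeff_nonunit p k * (real p ^ (2 * M) * (real p - 1)))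
     = real p ^ (2 * M * Suc k) * coeff_one p (Suc k)"
    unfolding coeff_one_Suc[OF r]
    by (simp add: algebra_simps power_add power2_eq_square mult_2_right)
  finally show ?thesis using x by (simp add: path_count_def del: sum.lessThan_Suc)
qed

text \<open>Here x - s is prime to p, so only \<open>theta p 0\<close> is nonzero, with value -1.
  Its contribution is cancelled by the increment \<open>r ^ Suc k\<close> in
  \<open>coeff_nonunit_Suc\<close>, which makes the value independent of s.\<close>

lemma path_count_Suc_nonunit:
  assumes p: "prime p" and x: "int p dvd x" and s: "s = 1 \<or> s = -1"
  shows "path_count p M (Suc k) s x =
    real p ^ Suc M * (real p ^ (2 * M * k) * (coeff_one p k + coeff_nonunit p k / real p))"
proof -
  have r: "real p > 1" using prime_gt_1_nat[OF p] by simp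
  have nd: "\<not> int p dvd x - s"
  proof
    assume "int p dvd x - s"
    then have "int p dvd s" using x by (metis dvd_diff_right_iff)
    then show False using s prime_gt_1_nat[OF p] by auto
  qed
  then have nds: "\<not> int p ^ Suc j dvd x - s" for j by (metis dvd_mult_left power_Suc)
  have th: "theta p j (x - s) = - of_bool (j = 0)" for j
    using nds[of j] nds[of "j - 1"] by (cases j) (simp_all add: theta_def)
  have "(\<Sum>j<Suc M. real p ^ j * real p ^ ((2 * M + 1 - j) * Suc k) * theta p j (x - s)) =
     - (real p ^ ((2 * M + 1) * Suc k))"
    unfolding th by (subst sum.lessThan_Suc_shift) simp
  moreover have "real p ^ (M * 2) = real p ^ M * real p ^ M" by (simp add: mult_2_right power_add)
  ultimately show ?thesis using r x
    by (simp add: path_count_def coeff_one_Suc coeff_nonunit_Suc del: sum.lessThan_Suc)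
      (simp add: field_simps power_add power2_eq_square mult_2)
qed

text \<open>The target starts as s = -u, by the count for one step, and each double step changes its
  sign. The starting vector must vary in the induction.\<close>

lemma card_paths_odd:
  assumes p: "prime p" and u: "u = 1 \<or> u = -1" and xy: "\<not> (int p dvd x \<and> int p dvd y)"
  shows "real (card (paths (int p ^ Suc M) u (2 * k + 1) x y)) = path_count p M k ((-1) ^ Suc k * u) x"
  using xy
proof (induction k arbitrary: x y)
  case 0
  have "real p > 1" using prime_gt_1_nat[OF p] by simp
  then show ?case using card_paths_1[OF p refl u, of M x y] sum_power_theta[of p "x + u" "Suc M"]
    by (simp add: path_count_def coeff_one_def coeff_nonunit_def del: sum.lessThan_Suc power_Suc)
next
  case (Suc k)
  have s: "- ((-1) ^ Suc k * u) = 1 \<or> - ((-1) ^ Suc k * u) = - 1"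
    using u by (cases "even k") auto
  let ?s = "(-1) ^ Suc k * u"
  have "real (card (paths (int p ^ Suc M) u (Suc (Suc (2 * k + 1))) x y)) =
     (if int p dvd x then of_int (int p ^ Suc M) * (\<Sum>z\<in>{0..<int p ^ Suc M}. path_count p M k ?s z)
      else \<Sum>z\<in>{0..<int p ^ Suc M}. \<Sum>a\<in>{0..<int p ^ Suc M}. path_count p M k ?s (a * z - x))"
    by (rule card_paths_two_steps[OF p refl]) (rule path_count_mod, erule Suc.IH, rule Suc.prems)
  also have "\<dots> = path_count p M (Suc k) (- ?s) x"
    using path_count_Suc_nonunit[OF p _ s]
    by (simp add: sum_path_count[OF p] sum_sum_path_count[OF p] del: power_Suc)
  finally show ?case by simp
qed

section \<open>Evaluation of the closed form at x = 1\<close>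

text \<open>For r an odd prime p this is the value of \<open>path_count\<close> for M = 0, s = -1
  and x = 1, that is, a count over the field with p elements.\<close>

definition base_count :: "real \<Rightarrow> nat \<Rightarrow> real" where
  "base_count r l = (r ^ (l + 1) - 1) * (r ^ l - 1) / (r\<^sup>2 - 1)"

text \<open>The summand \<open>r ^ l\<close> of \<open>coeff_one\<close> carries the same power of p
  as the \<open>theta p 0\<close> term and merges with it into 1 + \<open>theta p 0\<close>; the
  rest of \<open>coeff_one\<close> is r times \<open>base_count\<close>.\<close>

lemma path_count_1:
  assumes "p > 1" "l \<ge> 1"
  shows "path_count p M l s 1 = real p ^ (M * (2 * l - 1)) * base_count p l +
    (real p ^ ((2 * M + 1) * l) * (1 + theta p 0 (1 - s)) +
     (\<Sum>j<M. real p ^ Suc j * real p ^ ((2 * M - j) * l) * theta p (Suc j) (1 - s))) / real p ^ Suc M"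
proof -
  have "\<not> int p dvd 1" using assms by simp
  have e: "real p ^ (2 * M * l) * real p = real p ^ (M * (2 * l - 1)) * real p ^ Suc M"
    by (simp only: power_Suc2[symmetric] power_add[symmetric]) (use assms in \<open>simp add: algebra_simps\<close>)
  have "real p ^ (2 * M * l) * coeff_one p l =
    real p ^ (2 * M * l) * real p ^ l + (real p ^ (2 * M * l) * real p) * base_count p l"
    by (simp add: coeff_one_def base_count_def algebra_simps)
  also have "real p ^ (2 * M * l) * real p ^ l = real p ^ ((2 * M + 1) * l)"
    by (simp add: power_add[symmetric] algebra_simps)
  finally have c: "real p ^ (2 * M * l) * coeff_one p l = real p ^ ((2 * M + 1) * l) +
      real p ^ (M * (2 * l - 1)) * real p ^ Suc M * base_count p l" unfolding e .
  have "path_count p M l s 1 = (real p ^ (2 * M * l) * coeff_one p l +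
      (\<Sum>j<Suc M. real p ^ j * real p ^ ((2 * M + 1 - j) * l) * theta p j (1 - s))) / real p ^ Suc M"
    using \<open>\<not> int p dvd 1\<close> by (simp add: path_count_def del: sum.lessThan_Suc)
  also have "\<dots> = real p ^ (M * (2 * l - 1)) * base_count p l +
    (real p ^ ((2 * M + 1) * l) * (1 + theta p 0 (1 - s)) +
     (\<Sum>j<M. real p ^ Suc j * real p ^ ((2 * M - j) * l) * theta p (Suc j) (1 - s))) / real p ^ Suc M"
    unfolding c sum.lessThan_Suc_shift using assms by (simp add: add_divide_distrib distrib_left)
  finally show ?thesis .
qed

text \<open>Reversing the order of summation, j = M - 1 - i, makes the exponents increase by l - 1
  from one term to the next.\<close>

lemma sum_power_mult_geometric:
  fixes r :: real
  assumes "l \<ge> 1"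
  shows "(\<Sum>j<M. r ^ Suc j * r ^ ((2 * M - j) * l)) =
    r ^ Suc M * r ^ (Suc M * l - 1) * (\<Sum>i<M. r ^ (i * (l - 1)))"
proof -
  have "(\<Sum>j<M. r ^ Suc j * r ^ ((2 * M - j) * l)) =
      (\<Sum>i<M. r ^ Suc (M - Suc i) * r ^ ((2 * M - (M - Suc i)) * l))"
    by (rule sum.nat_diff_reindex[symmetric])
  also have "\<dots> = (\<Sum>i<M. r ^ Suc M * r ^ (Suc M * l - 1) * r ^ (i * (l - 1)))"
  proof (intro sum.cong refl)
    fix i assume "i \<in> {..<M}"
    then obtain t where t: "M = Suc (i + t)" by (metis lessThan_iff less_imp_Suc_add)
    obtain l' where l: "l = Suc l'" using assms by (cases l) auto
    have "Suc (M - Suc i) + (2 * M - (M - Suc i)) * l = Suc M + (Suc M * l - 1) + i * (l - 1)"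
      by (simp add: t l algebra_simps)
    then show "r ^ Suc (M - Suc i) * r ^ ((2 * M - (M - Suc i)) * l) =
        r ^ Suc M * r ^ (Suc M * l - 1) * r ^ (i * (l - 1))"
      by (simp only: power_add[symmetric])
  qed
  finally show ?thesis by (simp only: sum_distrib_left)
qed

lemma power_split_at_1:
  fixes r :: real
  assumes "r > 0" "l \<ge> 1"
  shows "r ^ ((2 * M + 1) * l) / r ^ Suc M = r ^ (M * (2 * l - 1)) * r ^ l / r"
proof -
  obtain l' where l: "l = Suc l'" using assms by (cases l) auto
  have "r ^ ((2 * M + 1) * l) * r = r ^ (M * (2 * l - 1)) * r ^ l * r ^ Suc M"
    by (simp only: power_Suc2[symmetric] power_add[symmetric]) (simp add: l algebra_simps)
  then show ?thesis using assms by (simp add: field_simps)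
qed

text \<open>The argument 1 - s is 0, so every \<open>theta\<close> equals p - 1 and all levels
  contribute, giving a geometric sum.\<close>

lemma path_count_1_1:
  assumes p: "p > 1" and l: "l \<ge> 1"
  shows "path_count p M l 1 1 = real p ^ (M * (2 * l - 1)) * (base_count p l + real p ^ l)
    + (\<Sum>i<M. real p ^ (i * (l - 1))) * real p ^ (Suc M * l - 1) * (real p - 1)"
proof -
  have r: "real p > 0" using p by simp
  have "path_count p M l 1 1 = real p ^ (M * (2 * l - 1)) * base_count p l +
    (real p ^ ((2 * M + 1) * l) * real p +
     (\<Sum>j<M. real p ^ Suc j * real p ^ ((2 * M - j) * l)) * (real p - 1)) / real p ^ Suc M"
    using p l by (simp add: path_count_1 theta_def sum_distrib_right)
  also have "\<dots> = real p ^ (M * (2 * l - 1)) * base_count p l +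
    (real p ^ ((2 * M + 1) * l) / real p ^ Suc M * real p +
     (\<Sum>i<M. real p ^ (i * (l - 1))) * real p ^ (Suc M * l - 1) * (real p - 1))"
    unfolding sum_power_mult_geometric[OF l] using r by (simp add: add_divide_distrib)
  finally show ?thesis
    unfolding power_split_at_1[OF r l] using r by (simp add: algebra_simps)
qed

text \<open>The argument 1 - s is 2, a unit modulo p: \<open>theta p 0\<close> is -1 and cancels the
  1 next to it, and the higher \<open>theta\<close> vanish.\<close>

lemma path_count_minus_1_1_odd:
  assumes p: "prime p" "odd p" and l: "l \<ge> 1"
  shows "path_count p M l (- 1) 1 = real p ^ (M * (2 * l - 1)) * base_count p l"
proof -
  have "\<not> int p dvd 2"
    using p by (metis int_dvd_int_iff of_nat_numeral primes_dvd_imp_eq two_is_prime_nat dvd_refl)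
  then have nd: "\<not> int p ^ Suc j dvd 2" for j by (metis dvd_mult_left power_Suc)
  have "theta p j 2 = - of_bool (j = 0)" for j
    using nd[of j] nd[of "j - 1"] by (cases j) (simp_all add: theta_def)
  then show ?thesis using prime_gt_1_nat[OF p(1)] l by (simp add: path_count_1)
qed

text \<open>The argument 2 now has valuation 1, so \<open>theta 2 0\<close> is 1,
  \<open>theta 2 1\<close> is -1, and the higher ones vanish. The modulus is at least 4, so that
  level 1 is present.\<close>

lemma path_count_minus_1_1_two:
  assumes l: "l \<ge> 1"
  shows "path_count 2 (Suc M) l (- 1) 1 = 2 ^ (Suc M * (2 * l - 1)) * (base_count 2 l + 2 ^ l - 1)"
proof -
  have nd: "\<not> (2::int) ^ Suc (Suc j) dvd 2" for j
  proof
    assume "(2::int) ^ Suc (Suc j) dvd 2"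
    then have "(2::int) ^ Suc (Suc j) \<le> 2" by (rule zdvd_imp_le) simp
    then show False using one_le_power[of "2::int" j] unfolding power_Suc by linarith
  qed
  have th0: "theta 2 0 2 = 1" by (simp add: theta_def)
  have th: "theta 2 (Suc j) 2 = - of_bool (j = 0)" for j
    using nd[of j] nd[of "j - 1"] by (cases j) (simp_all add: theta_def)
  have "path_count 2 (Suc M) l (- 1) 1 = 2 ^ (Suc M * (2 * l - 1)) * base_count 2 l +
    (2 ^ ((2 * Suc M + 1) * l) * 2 - 2 * 2 ^ (2 * Suc M * l)) / 2 ^ Suc (Suc M)"
    using l by (simp add: path_count_1 th0 th sum.lessThan_Suc_shift del: sum.lessThan_Suc)
  also have "2 ^ ((2 * Suc M + 1) * l) * 2 - 2 * 2 ^ (2 * Suc M * l) =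
     (2 ^ l - 1) * (2 ^ (2 * Suc M * l) * (2 :: real))"
    unfolding add_mult_distrib power_add by (simp add: algebra_simps)
  also have "(2 ^ (2 * Suc M * l) * (2 :: real)) = 2 ^ (Suc M * (2 * l - 1)) * 2 ^ Suc (Suc M)"
  proof -
    obtain k where "l = Suc k" using l by (cases l) auto
    then have "Suc (2 * Suc M * l) = Suc M * (2 * l - 1) + Suc (Suc M)" by (simp add: algebra_simps)
    then show ?thesis by (simp only: power_Suc2[symmetric] power_add[symmetric])
  qed
  also have "(2 ^ l - 1) * (2 ^ (Suc M * (2 * l - 1)) * 2 ^ Suc (Suc M)) / 2 ^ Suc (Suc M) =
      (2 ^ l - 1) * (2 :: real) ^ (Suc M * (2 * l - 1))"
    by simp
  finally show ?thesis by (simp add: algebra_simps)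
qed

section \<open>The explicit formulas\<close>

text \<open>Dropping the head leaves 2 l + 1 steps from (1, 0): l double steps and the last single
  one.\<close>

lemma w_eq_path_count:
  assumes p: "prime p" and u: "u = 1 \<or> u = -1"
  shows "real (w (residue_ring (int p ^ Suc M)) (2 * l + 2) (zclass (int p ^ Suc M) u)) =
    path_count p M l ((-1) ^ Suc l * u) 1"
proof -
  have "int p ^ Suc M > 1" using prime_gt_1_nat[OF p] by (intro one_less_power) auto
  from w_residue_ring_eq_card_paths[OF this u, of "2 * l + 1"]
  have "w (residue_ring (int p ^ Suc M)) (2 * l + 2) (zclass (int p ^ Suc M) u)
    = card (paths (int p ^ Suc M) u (2 * l + 1) 1 0)"
    by simp
  then show ?thesis
    using card_paths_odd[OF p u, of 1 0 M l] prime_gt_1_nat[OF p] by simp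
qed

text \<open>The bound on l, which comes from n \<ge> 4, keeps the ratio \<open>r ^ (l - 1)\<close>
  away from 1.\<close>

lemma geometric_sum_power:
  fixes r :: real
  assumes "r > 1" "l \<ge> 2"
  shows "(\<Sum>i<M. r ^ (i * (l - 1))) = (r ^ (M * (l - 1)) - 1) / (r ^ (l - 1) - 1)"
proof -
  have "r ^ (l - 1) > 1" using assms by (intro one_less_power) auto
  then show ?thesis
    using geometric_sum[of "r ^ (l - 1)" M] by (simp add: power_mult[symmetric] mult.commute)
qed

text \<open>One factor \<open>2 ^ (n - 1)\<close>, with n = 2 l, is absorbed into the main term;
  this is why the formulas for powers of 2 have m - 2 in place of m - 1.\<close>

lemma base_count_two:
  assumes "l \<ge> 1"
  shows "2 ^ (2 * l - 1) * (base_count 2 l + 2 ^ l - 1) = (4 ^ (2 * l) - 2 ^ (2 * l)) / 3"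
proof -
  obtain k where l: "l = Suc k" using assms by (cases l) auto
  define X :: real where "X = 2 ^ k"
  have "(2::real) ^ (2 * l - 1) = 2 * X\<^sup>2" "(2::real) ^ (2 * l) = 4 * X\<^sup>2" "(4::real) ^ (2 * l) = 16 * X ^ 4"
    "(2::real) ^ l = 2 * X"
  proof -
    have "(4::real) ^ (2 * l) = (2 ^ 2) ^ (2 * l)" by simp
    also have "\<dots> = 2 ^ (4 * k + 4)" unfolding power_mult[symmetric] by (simp add: l power_add)
    finally show "(4::real) ^ (2 * l) = 16 * X ^ 4" by (simp add: X_def power_add power_mult[symmetric] mult.commute)
  qed (simp_all add: l X_def power_mult[symmetric] mult.commute)
  then show ?thesis by (simp add: base_count_def) (simp add: field_simps power2_eq_square power4_eq_xxxx)
qed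

text \<open>The parity of l and the sign u enter only through s = (-1)^(l+1) u, so two cases cover
  all four formulas.\<close>

lemma w_odd_prime_power:
  assumes p: "prime p" "odd p" and m: "m \<ge> 1" and n: "n = 2 * l" "n \<ge> 4" and u: "u = 1 \<or> u = -1"
  shows "real (w (residue_ring (int p ^ m)) (n + 2) (zclass (int p ^ m) u)) =
    (if (-1) ^ Suc l * u = 1 then
       real p ^ ((m - 1) * (n - 1))
         * ((real p ^ (l + 1) - 1) * (real p ^ l - 1) / (real p ^ 2 - 1) + real p ^ l)
       + (real p ^ ((m - 1) * (n - 1 - l)) - 1) / (real p ^ (n - 1 - l) - 1)
         * real p ^ (m * l - 1) * (real p - 1)
     else real p ^ ((m - 1) * (n - 1)) * (real p ^ (l + 1) - 1) * (real p ^ l - 1)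
            / (real p ^ 2 - 1))"
proof -
  obtain M where m: "m = Suc M" using m by (cases m) auto
  have p1: "p > 1" using prime_gt_1_nat[OF p(1)] .
  have l: "l \<ge> 1" "l \<ge> 2" using n by auto
  have nl: "n - 1 - l = l - 1" using n by simp
  have s: "(-1) ^ Suc l * u = 1 \<or> (-1) ^ Suc l * u = - 1"
    using u by (cases "even l") auto
  show ?thesis
  proof (cases "(-1) ^ Suc l * u = 1")
    case True
    have "real (w (residue_ring (int p ^ m)) (n + 2) (zclass (int p ^ m) u)) = path_count p M l 1 1"
      unfolding m n(1) w_eq_path_count[OF p(1) u] True ..
    with True show ?thesis
      using path_count_1_1[OF p1 l(1), of M] geometric_sum_power[of "real p" l M] p1 l
      by (simp only: nl if_True) (simp add: m n(1) base_count_def)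
  next
    case False
    with s have eq: "(-1) ^ Suc l * u = - 1" by blast
    have "real (w (residue_ring (int p ^ m)) (n + 2) (zclass (int p ^ m) u)) = path_count p M l (- 1) 1"
      unfolding m n(1) w_eq_path_count[OF p(1) u] eq ..
    with False show ?thesis
      using path_count_minus_1_1_odd[OF p l(1), of M]
      by (simp only: if_False) (simp add: m n(1) base_count_def)
  qed
qed

lemma w_two_power:
  assumes m: "m \<ge> 2" and n: "n = 2 * l" "n \<ge> 4" and u: "u = 1 \<or> u = -1"
  shows "real (w (residue_ring (2 ^ m)) (n + 2) (zclass (2 ^ m) u)) =
    (if (-1) ^ Suc l * u = 1 then
       2 ^ ((m - 2) * (n - 1)) * ((4 ^ n + 2 ^ (n + 1)) / 3)
       + (2 ^ ((m - 2) * (n - 1 - l)) - 1) / (2 ^ (n - 1 - l) - 1) * 2 ^ (m * l - 1)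
     else 2 ^ ((m - 2) * (n - 1)) * ((4 ^ n - 2 ^ n) / 3))"
proof -
  obtain M where m: "m = Suc (Suc M)" using m by (metis Suc_le_D numeral_2_eq_2 Suc_le_mono)
  have l: "l \<ge> 1" "l \<ge> 2" using n by auto
  have nl: "n - 1 - l = l - 1" using n by simp
  have s: "(-1) ^ Suc l * u = 1 \<or> (-1) ^ Suc l * u = - 1"
    using u by (cases "even l") auto
  have W: "real (w (residue_ring (2 ^ m)) (n + 2) (zclass (2 ^ m) u)) =
      path_count 2 (Suc M) l ((-1) ^ Suc l * u) 1"
    using w_eq_path_count[OF two_is_prime_nat u, of "Suc M" l] unfolding m n(1) by simp
  have E: "(2::real) ^ (Suc M * (2 * l - 1)) = 2 ^ (M * (n - 1)) * 2 ^ (2 * l - 1)"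
    by (simp add: n(1) power_add)
  show ?thesis
  proof (cases "(-1) ^ Suc l * u = 1")
    case True
    \<comment> \<open>The last term i = M of the geometric sum has the same power of 2 as the main
      term. Moving it there turns \<open>base_count 2 l + 2 ^ l\<close> into
      \<open>base_count 2 l + 2 ^ l + 1\<close> and leaves M = m - 2 terms.\<close>
    have top: "(2::real) ^ (M * (l - 1)) * 2 ^ (Suc (Suc M) * l - 1) = 2 ^ (Suc M * (2 * l - 1))"
    proof -
      obtain k where "l = Suc k" using l by (cases l) auto
      then have "M * (l - 1) + (Suc (Suc M) * l - 1) = Suc M * (2 * l - 1)" by (simp add: algebra_simps)
      then show ?thesis by (simp only: power_add[symmetric])
    qed
    have "path_count 2 (Suc M) l 1 1 = 2 ^ (Suc M * (2 * l - 1)) * (base_count 2 l + 2 ^ l + 1)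
      + (\<Sum>i<M. 2 ^ (i * (l - 1))) * 2 ^ (m * l - 1)"
      using path_count_1_1[of 2 l "Suc M"] l top unfolding m by (simp add: algebra_simps)
    also have "2 ^ (Suc M * (2 * l - 1)) * (base_count 2 l + 2 ^ l + 1) =
        2 ^ (M * (n - 1)) * ((4 ^ n + 2 ^ (n + 1)) / 3)"
    proof -
      have "2 ^ (2 * l - 1) * (base_count 2 l + 2 ^ l + 1) =
          2 ^ (2 * l - 1) * (base_count 2 l + 2 ^ l - 1) + 2 * 2 ^ (2 * l - 1)"
        by (simp add: algebra_simps)
      also have "2 * 2 ^ (2 * l - 1) = (2::real) ^ (2 * l)"
        using l by (simp add: power_Suc[symmetric] del: power_Suc)
      finally have "2 ^ (2 * l - 1) * (base_count 2 l + 2 ^ l + 1) = (4 ^ n + 2 ^ (n + 1)) / 3"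
        unfolding base_count_two[OF l(1)] by (simp add: n(1) field_simps)
      then show ?thesis unfolding E by (simp only: mult.assoc)
    qed
    finally show ?thesis using True W geometric_sum_power[of 2 l M] l
      by (simp only: nl if_True) (simp add: m)
  next
    case False
    with s have "(-1) ^ Suc l * u = - 1" by blast
    with False W show ?thesis
      using path_count_minus_1_1_two[OF l(1), of M] base_count_two[OF l(1)]
      by (simp only: if_False E mult.assoc) (simp add: m n(1))
  qed
qed

theorem theorem1p4:
  shows
    "(\<forall>(p::nat) (m::nat) (n::nat) (l::nat).
        prime p \<and> odd p \<and> m \<ge> 2 \<and> n = 2 * l \<and> n \<ge> 4 \<longrightarrow>
        (even l \<longrightarrow>
           real (w (residue_ring (int p ^ m)) (n + 2) (zclass (int p ^ m) 1))
             = real p ^ ((m - 1) * (n - 1)) * (real p ^ (l + 1) - 1) * (real p ^ l - 1)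
                 / (real p ^ 2 - 1)
         \<and> real (w (residue_ring (int p ^ m)) (n + 2) (zclass (int p ^ m) (- 1)))
             = real p ^ ((m - 1) * (n - 1))
                 * ((real p ^ (l + 1) - 1) * (real p ^ l - 1) / (real p ^ 2 - 1) + real p ^ l)
               + (real p ^ ((m - 1) * (n - 1 - l)) - 1) / (real p ^ (n - 1 - l) - 1)
                 * real p ^ (m * l - 1) * (real p - 1))
      \<and> (odd l \<longrightarrow>
           real (w (residue_ring (int p ^ m)) (n + 2) (zclass (int p ^ m) 1))
             = real p ^ ((m - 1) * (n - 1))
                 * ((real p ^ (l + 1) - 1) * (real p ^ l - 1) / (real p ^ 2 - 1) + real p ^ l)
               + (real p ^ ((m - 1) * (n - 1 - l)) - 1) / (real p ^ (n - 1 - l) - 1)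
                 * real p ^ (m * l - 1) * (real p - 1)
         \<and> real (w (residue_ring (int p ^ m)) (n + 2) (zclass (int p ^ m) (- 1)))
             = real p ^ ((m - 1) * (n - 1)) * (real p ^ (l + 1) - 1) * (real p ^ l - 1)
                 / (real p ^ 2 - 1)))
   \<and> (\<forall>(m::nat) (n::nat) (l::nat).
        m \<ge> 3 \<and> n = 2 * l \<and> n \<ge> 4 \<longrightarrow>
        (even l \<longrightarrow>
           real (w (residue_ring (2 ^ m)) (n + 2) (zclass (2 ^ m) 1))
             = 2 ^ ((m - 2) * (n - 1)) * ((4 ^ n - 2 ^ n) / 3)
         \<and> real (w (residue_ring (2 ^ m)) (n + 2) (zclass (2 ^ m) (- 1)))
             = 2 ^ ((m - 2) * (n - 1)) * ((4 ^ n + 2 ^ (n + 1)) / 3)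
               + (2 ^ ((m - 2) * (n - 1 - l)) - 1) / (2 ^ (n - 1 - l) - 1) * 2 ^ (m * l - 1))
      \<and> (odd l \<longrightarrow>
           real (w (residue_ring (2 ^ m)) (n + 2) (zclass (2 ^ m) 1))
             = 2 ^ ((m - 2) * (n - 1)) * ((4 ^ n + 2 ^ (n + 1)) / 3)
               + (2 ^ ((m - 2) * (n - 1 - l)) - 1) / (2 ^ (n - 1 - l) - 1) * 2 ^ (m * l - 1)
         \<and> real (w (residue_ring (2 ^ m)) (n + 2) (zclass (2 ^ m) (- 1)))
             = 2 ^ ((m - 2) * (n - 1)) * ((4 ^ n - 2 ^ n) / 3)))"
  using w_odd_prime_power[of _ _ _ _ 1] w_odd_prime_power[of _ _ _ _ "-1"]
    w_two_power[of _ _ _ 1] w_two_power[of _ _ _ "-1"]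
  by (intro conjI allI impI) (simp_all del: of_nat_power)

end
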